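(* Let $f$ be a continuous real-valued function on $[0,\infty)$, let $s\in(0,1/2)\cup(1/2,1)$ and $\alpha(s)=1-2s$. The following statements are equivalent: (i) $f$ is operator monotone on $[0,\infty)$; (ii) for any positive definite matrices $A$ and $B$ (of the same, arbitrary, size), $$f(A\sharp B)\le f\left(\frac{A\sharp_sB+A\sharp_{1-s}B}{2}\right);$$ (iii) for any positive definite matrices $A$ and $B$ (of the same, arbitrary, size), $$f\left(\frac{A\sharp_sB+A\sharp_{1-s}B}{2}\right)\le f\left(\alpha(s)^2\,\frac{A+B}{2}+(1-\alpha(s)^2)\,A\sharp B\right);$$ (iv) for any positive definite matrices $A$ and $B$ (of the same, arbitrary, size), $$f\left(\alpha(s)^2\,\frac{A+B}{2}+(1-\alpha(s)^2)\,A\sharp B\right)\le f\left(\frac{A+B}{2}\right).$$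
   Context: Matrices are complex; $\le$ between Hermitian matrices is the Loewner order, and functions of Hermitian matrices are defined by functional calculus. For positive definite $A,B$ and $t\in[0,1]$, $A\sharp_tB=A^{1/2}(A^{-1/2}BA^{-1/2})^tA^{1/2}$ and $A\sharp B=A\sharp_{1/2}B$. A real function $f$ on $[0,\infty)$ is operator monotone if for every $n$ and all positive semidefinite $n\times n$ matrices $X\le Y$ one has $f(X)\le f(Y)$. *)

theory Defs
  imports Complex_Main "Jordan_Normal_Form.Schur_Decomposition"
begin

(* mat_adjoint A swaps the dimensions of A, so this forces A to be square. *)
definition hermitian_mat :: "complex mat \<Rightarrow> bool" where
  "hermitian_mat A \<longleftrightarrow> mat_adjoint A = A"

definition unitary_mat :: "complex mat \<Rightarrow> bool" where
  "unitary_mat U \<longleftrightarrow> square_mat U \<and> inverts_mat U (mat_adjoint U) \<and> inverts_mat (mat_adjoint U) U"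

(* The order on complex numbers is that of Complex_Order: 0 <= z means that z is real and
   nonnegative.  The quadratic form of A at v is (A *\<^sub>v v) \<bullet>c v, because
   \<bullet>c conjugates its second argument. *)
definition pos_semidef_mat :: "complex mat \<Rightarrow> bool" where
  "pos_semidef_mat A \<longleftrightarrow> hermitian_mat A \<and>
     (\<forall>v \<in> carrier_vec (dim_row A). 0 \<le> (A *\<^sub>v v) \<bullet>c v)"

definition pos_def_mat :: "complex mat \<Rightarrow> bool" where
  "pos_def_mat A \<longleftrightarrow> hermitian_mat A \<and>
     (\<forall>v \<in> carrier_vec (dim_row A). v \<noteq> 0\<^sub>v (dim_row A) \<longrightarrow> 0 < (A *\<^sub>v v) \<bullet>c v)"

(* The library's \<le> on matrices is entrywise, hence a separate symbol. *)
definition loewner_le :: "complex mat \<Rightarrow> complex mat \<Rightarrow> bool" (infix \<open>\<le>\<^sub>L\<close> 50) where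
  "A \<le>\<^sub>L B \<longleftrightarrow> hermitian_mat A \<and> hermitian_mat B \<and> dim_row A = dim_row B \<and>
     pos_semidef_mat (B - A)"

definition real_diag_mat :: "nat \<Rightarrow> (nat \<Rightarrow> real) \<Rightarrow> complex mat" where
  "real_diag_mat n d = mat n n (\<lambda>(i, j). if i = j then complex_of_real (d i) else 0)"

(* Functional calculus: A = U diag(d) U' gives f(A) = U diag(f d) U', where U' is the adjoint
   of U.  For Hermitian A such a diagonalization exists and the result does not depend on its
   choice; only the values of f on the spectrum of A matter. *)
definition mat_fun :: "(real \<Rightarrow> real) \<Rightarrow> complex mat \<Rightarrow> complex mat" where
  "mat_fun f A = (THE X. \<exists>U d. U \<in> carrier_mat (dim_row A) (dim_row A) \<and> unitary_mat U \<and>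
     A = U * real_diag_mat (dim_row A) d * mat_adjoint U \<and>
     X = U * real_diag_mat (dim_row A) (\<lambda>i. f (d i)) * mat_adjoint U)"

definition mat_powr :: "complex mat \<Rightarrow> real \<Rightarrow> complex mat" where
  "mat_powr A t = mat_fun (\<lambda>x. x powr t) A"

definition geom_mean :: "complex mat \<Rightarrow> real \<Rightarrow> complex mat \<Rightarrow> complex mat"
    (\<open>_ \<sharp>\<^bsub>_\<^esub> _\<close> [71, 0, 71] 70) where
  "A \<sharp>\<^bsub>t\<^esub> B =
     mat_powr A (1/2) *
     mat_powr (mat_powr A (-1/2) * B * mat_powr A (-1/2)) t *
     mat_powr A (1/2)"

definition operator_monotone :: "(real \<Rightarrow> real) \<Rightarrow> bool" where
  "operator_monotone f \<longleftrightarrow>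
     (\<forall>n. \<forall>X \<in> carrier_mat n n. \<forall>Y \<in> carrier_mat n n.
        pos_semidef_mat X \<longrightarrow> pos_semidef_mat Y \<longrightarrow> X \<le>\<^sub>L Y \<longrightarrow> mat_fun f X \<le>\<^sub>L mat_fun f Y)"

end

(* Two Hermitian matrices, one of them positive definite, are diagonal after a common congruence T:
   A = T diag(a) T', B = T diag(b) T'. Every mean in the theorem is congruence invariant, so it acts
   entrywise, with entries a p(b/a) for a scalar function p. The implications from (i) therefore
   reduce to scalar inequalities, which for x = exp(2w) compare 1, cosh(alpha w),
   alpha^2 cosh w + 1 - alpha^2 and cosh w.

   Conversely, let p <= q be consecutive functions of this list. They agree at 1 but not everywhere,
   so q/p takes every value in some interval [1, r] with r > 1. If X = T diag(x) T' and
   Y = T diag(y) T' with x <= y <= r x, then x = a p(b/a) and y = a q(b/a) can be solved for a, b > 0,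
   so the hypothesis gives f(X) <= f(Y). The ratio restriction is removed by a finite chain of such
   steps, and positive semidefinite X <= Y are limits of X + cI <= Y + cI as c tends to 0. *)
theory Submission
  imports Defs
begin

subsection \<open>Adjoints and diagonal matrices\<close>

lemma mat_adjoint_dim [simp]:
  "dim_row (mat_adjoint A) = dim_col A" "dim_col (mat_adjoint A) = dim_row A"
  by (simp_all add: mat_adjoint_def)

lemma mat_adjoint_carrier [simp, intro]:
  "A \<in> carrier_mat n m \<Longrightarrow> mat_adjoint A \<in> carrier_mat m n"
  by (rule carrier_matI) (simp_all add: carrier_matD)

lemma mat_adjoint_index [simp]:
  "i < dim_col A \<Longrightarrow> j < dim_row A \<Longrightarrow> mat_adjoint A $$ (i, j) = conjugate (A $$ (j, i))"
  by (simp add: mat_adjoint_def mat_of_rows_def)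

lemma mat_adjoint_mat_adjoint [simp]: "mat_adjoint (mat_adjoint A) = A"
  by (rule eq_matI) auto

lemma mat_adjoint_mult:
  assumes "A \<in> carrier_mat n m" "B \<in> carrier_mat m k"
  shows "mat_adjoint (A * B) = mat_adjoint B * mat_adjoint (A :: complex mat)"
proof (rule eq_matI)
  fix i j assume "i < dim_row (mat_adjoint B * mat_adjoint A)"
    "j < dim_col (mat_adjoint B * mat_adjoint A)"
  then show "mat_adjoint (A * B) $$ (i, j) = (mat_adjoint B * mat_adjoint A) $$ (i, j)"
    using assms by (simp add: scalar_prod_def mult.commute)
qed (use assms in auto)

lemma mult_mat_vec_cscalar:
  assumes "M \<in> carrier_mat n m" "u \<in> carrier_vec m" "v \<in> carrier_vec n"
  shows "(M *\<^sub>v u) \<bullet>c v = u \<bullet>c (mat_adjoint M *\<^sub>v (v :: complex vec))"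
proof -
  have "(M *\<^sub>v u) \<bullet>c v = (\<Sum>i<n. \<Sum>j<m. M $$ (i, j) * u $ j * cnj (v $ i))"
    using assms by (simp add: scalar_prod_def sum_distrib_right lessThan_atLeast0)
  also have "\<dots> = (\<Sum>j<m. \<Sum>i<n. M $$ (i, j) * u $ j * cnj (v $ i))"
    by (rule sum.swap)
  also have "\<dots> = u \<bullet>c (mat_adjoint M *\<^sub>v v)"
    using assms by (simp add: scalar_prod_def sum_distrib_left lessThan_atLeast0 mult_ac)
  finally show ?thesis .
qed

section \<open>Real diagonal matrices and congruences of them\<close>

lemma real_diag_mat_dim [simp]:
  "dim_row (real_diag_mat n d) = n" "dim_col (real_diag_mat n d) = n"
  "real_diag_mat n d \<in> carrier_mat n n"
  by (simp_all add: real_diag_mat_def)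

lemma real_diag_mat_index [simp]:
  "i < n \<Longrightarrow> j < n \<Longrightarrow> real_diag_mat n d $$ (i, j) = (if i = j then of_real (d i) else 0)"
  by (simp add: real_diag_mat_def)

lemma real_diag_mat_adjoint [simp]: "mat_adjoint (real_diag_mat n d) = real_diag_mat n d"
  by (rule eq_matI) auto

lemma real_diag_mat_one: "real_diag_mat n (\<lambda>i. 1) = 1\<^sub>m n"
  by (rule eq_matI) auto

lemma index_mult_real_diag_mat:
  assumes "A \<in> carrier_mat m n" "i < m" "j < n"
  shows "(A * real_diag_mat n d) $$ (i, j) = A $$ (i, j) * of_real (d j)"
  using assms by (simp add: scalar_prod_def if_distrib cong: if_cong)

lemma index_real_diag_mat_mult:
  assumes "A \<in> carrier_mat n m" "i < n" "j < m"
  shows "(real_diag_mat n d * A) $$ (i, j) = of_real (d i) * A $$ (i, j)"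
  using assms by (simp add: scalar_prod_def if_distrib[of "\<lambda>x. x * _"] cong: if_cong)

lemma real_diag_mat_mult:
  "real_diag_mat n a * real_diag_mat n b = real_diag_mat n (\<lambda>i. a i * b i)"
  by (rule eq_matI) (auto simp: index_real_diag_mat_mult[where m = n] simp del: index_mult_mat(1))

text \<open>With unitary \<open>T\<close> this is a spectral decomposition, with invertible
  \<open>T\<close> a congruence to a diagonal matrix; one form serves both. Matrices that share
  \<open>T\<close> are added and scaled through their real coefficients alone.\<close>

definition diag_congruence :: "nat \<Rightarrow> complex mat \<Rightarrow> (nat \<Rightarrow> real) \<Rightarrow> complex mat" where
  "diag_congruence n T a = T * real_diag_mat n a * mat_adjoint T"

lemma diag_congruence_carrier [simp, intro]:
  "T \<in> carrier_mat n n \<Longrightarrow> diag_congruence n T a \<in> carrier_mat n n"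
  by (auto simp: diag_congruence_def)

lemma diag_congruence_index:
  assumes "T \<in> carrier_mat n n" "i < n" "j < n"
  shows "diag_congruence n T a $$ (i, j) = (\<Sum>k<n. T $$ (i, k) * of_real (a k) * cnj (T $$ (j, k)))"
proof -
  have "diag_congruence n T a $$ (i, j)
      = (\<Sum>k<n. (T * real_diag_mat n a) $$ (i, k) * cnj (T $$ (j, k)))"
    using assms by (simp add: diag_congruence_def scalar_prod_def[of _ "col _ _"] lessThan_atLeast0
        del: index_mult_mat(1)) (simp add: scalar_prod_def)
  then show ?thesis
    using assms by (simp add: index_mult_real_diag_mat[where m = n] del: index_mult_mat(1))
qed

lemma diag_congruence_cong:
  "(\<And>i. i < n \<Longrightarrow> a i = b i) \<Longrightarrow> diag_congruence n T a = diag_congruence n T b"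
  unfolding diag_congruence_def real_diag_mat_def by (subst cong_mat[of n n n n]) auto

lemma diag_congruence_hermitian:
  "T \<in> carrier_mat n n \<Longrightarrow> hermitian_mat (diag_congruence n T a)"
  unfolding hermitian_mat_def
  by (rule eq_matI) (auto simp: diag_congruence_index mult_ac
     carrier_matD[OF diag_congruence_carrier])

lemma diag_congruence_add:
  "T \<in> carrier_mat n n \<Longrightarrow>
    diag_congruence n T a + diag_congruence n T b = diag_congruence n T (\<lambda>i. a i + b i)"
  by (rule eq_matI) (auto simp: diag_congruence_index algebra_simps sum.distrib
     carrier_matD[OF diag_congruence_carrier])

lemma diag_congruence_minus:
  "T \<in> carrier_mat n n \<Longrightarrow>
    diag_congruence n T a - diag_congruence n T b = diag_congruence n T (\<lambda>i. a i - b i)"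
  by (rule eq_matI) (auto simp: diag_congruence_index algebra_simps sum_subtractf
     carrier_matD[OF diag_congruence_carrier])

lemma diag_congruence_smult:
  "T \<in> carrier_mat n n \<Longrightarrow>
    complex_of_real c \<cdot>\<^sub>m diag_congruence n T a = diag_congruence n T (\<lambda>i. c * a i)"
  by (rule eq_matI) (auto simp: diag_congruence_index sum_distrib_left mult_ac
     carrier_matD[OF diag_congruence_carrier])

lemma diag_congruence_mult_left:
  assumes "W \<in> carrier_mat n n" "T \<in> carrier_mat n n"
  shows "diag_congruence n (W * T) a = W * diag_congruence n T a * mat_adjoint W"
  using assms by (simp add: diag_congruence_def mat_adjoint_mult[of _ n n _ n] assoc_mult_mat[of _ n n _ n _ n]
      mult_carrier_mat[of _ n n _ n])

lemma diag_congruence_mult_diag: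
  assumes "T \<in> carrier_mat n n"
  shows "diag_congruence n (T * real_diag_mat n c) a = diag_congruence n T (\<lambda>i. c i * a i * c i)"
proof -
  have "diag_congruence n (T * real_diag_mat n c) a =
     T * (real_diag_mat n c * real_diag_mat n a * real_diag_mat n c) * mat_adjoint T"
    using assms by (simp add: diag_congruence_def mat_adjoint_mult[of _ n n _ n] assoc_mult_mat[of _ n n _ n _ n]
      mult_carrier_mat[of _ n n _ n])
  then show ?thesis by (simp add: real_diag_mat_mult diag_congruence_def)
qed

text \<open>Moving \<open>T\<close> across the inner product leaves the form of a real diagonal
  matrix at \<open>mat_adjoint T *\<^sub>v v\<close>, a weighted sum of squared moduli. The
  positivity criteria and the limit argument below rest on this sum.\<close>

lemma diag_congruence_quadratic_form:
  assumes "T \<in> carrier_mat n n" "v \<in> carrier_vec n"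
  shows "(diag_congruence n T a *\<^sub>v v) \<bullet>c v
    = complex_of_real (\<Sum>k<n. a k * (cmod ((mat_adjoint T *\<^sub>v v) $ k))\<^sup>2)"
proof -
  define w where "w = mat_adjoint T *\<^sub>v v"
  have w: "w \<in> carrier_vec n" using assms by (simp add: w_def mult_mat_vec_carrier[of _ n n])
  have "(diag_congruence n T a *\<^sub>v v) \<bullet>c v = (real_diag_mat n a *\<^sub>v w) \<bullet>c w"
    using assms w unfolding w_def diag_congruence_def
    by (simp add: assoc_mult_mat[of _ n n _ n _ n] assoc_mult_mat_vec[of _ n n _ n]
      mult_carrier_mat[of _ n n _ n] mult_mat_vec_carrier[of _ n n] mult_mat_vec_cscalar[of T n n])
  also have "\<dots> = (\<Sum>k<n. of_real (a k) * w $ k * cnj (w $ k))"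
    using w by (simp add: scalar_prod_def lessThan_atLeast0 if_distrib[of "\<lambda>x. x * _"] cong: if_cong)
  also have "\<dots> = complex_of_real (\<Sum>k<n. a k * (cmod (w $ k))\<^sup>2)"
    by (simp add: mult.assoc complex_norm_square del: of_real_power)
  finally show ?thesis by (simp add: w_def)
qed


subsection \<open>The spectral theorem\<close>

lemma unitary_mat_iff:
  assumes "U \<in> carrier_mat n n"
  shows "unitary_mat U \<longleftrightarrow> U * mat_adjoint U = 1\<^sub>m n"
proof -
  have "mat_adjoint U * U = 1\<^sub>m n" if "U * mat_adjoint U = 1\<^sub>m n"
    using mat_mult_left_right_inverse[OF _ _ that] assms by simp
  then show ?thesis
    using assms by (auto simp: unitary_mat_def inverts_mat_def)
qed

lemma unitary_matD:
  assumes "U \<in> carrier_mat n n" "unitary_mat U"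
  shows "U * mat_adjoint U = 1\<^sub>m n" "mat_adjoint U * U = 1\<^sub>m n"
  using assms by (auto simp: unitary_mat_def inverts_mat_def)

lemma diag_congruence_one:
  assumes "U \<in> carrier_mat n n" "unitary_mat U"
  shows "diag_congruence n U (\<lambda>i. 1) = 1\<^sub>m n"
  using assms(1)
  by (simp add: diag_congruence_def real_diag_mat_one unitary_matD[OF assms] right_mult_one_mat[of _ n n])

lemma unitary_mat_mult:
  assumes "U \<in> carrier_mat n n" "V \<in> carrier_mat n n" "unitary_mat U" "unitary_mat V"
  shows "unitary_mat (U * V)"
proof -
  have "U * V * mat_adjoint (U * V) = U * (V * mat_adjoint V) * mat_adjoint U"
    using assms(1,2) by (simp add: mat_adjoint_mult[of _ n n _ n] assoc_mult_mat[of _ n n _ n _ n]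
      mult_carrier_mat[of _ n n _ n])
  then show ?thesis
    using assms(1,2) unitary_matD[OF assms(1,3)] unitary_matD[OF assms(2,4)]
    by (simp add: unitary_mat_iff[of _ n] mult_carrier_mat[of _ n n _ n])
qed

lemma mat_adjoint_four_block:
  assumes "A \<in> carrier_mat n1 m1" "B \<in> carrier_mat n1 m2" "C \<in> carrier_mat n2 m1" "D \<in> carrier_mat n2 m2"
  shows "mat_adjoint (four_block_mat A B C D)
    = four_block_mat (mat_adjoint A) (mat_adjoint C) (mat_adjoint B) (mat_adjoint D)"
  by (rule eq_matI) (simp_all add: carrier_matD[OF assms(1)] carrier_matD[OF assms(2)]
      carrier_matD[OF assms(3)] carrier_matD[OF assms(4)])

text \<open>Complete \<open>v\<close> to a basis and orthogonalize: Gram-Schmidt keeps the first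
  vector, and normalizing the columns only rescales it, hence the factor \<open>c\<close>.\<close>

lemma unitary_mat_with_first_col:
  assumes v: "v \<in> carrier_vec n" "v \<noteq> 0\<^sub>v n"
  obtains U c where "U \<in> carrier_mat n n" "unitary_mat U" "col U 0 = c \<cdot>\<^sub>v v"
proof -
  interpret cof_vec_space n "TYPE(complex)" .
  define b where "b = basis_completion v"
  define ws where "ws = gram_schmidt n b"
  define W where "W = mat_of_cols n ws"
  have n: "0 < n" using v by (cases n) auto
  note b_props = basis_completion[OF v, folded b_def]
  then obtain vs where bv: "b = v # vs" using n by (cases b) auto
  have ws: "set ws \<subseteq> carrier_vec n" "corthogonal ws" "length ws = n"
    using gram_schmidt_result[OF b_props(2,4,5) refl, folded ws_def] b_props(6) by auto
  have "hd ws = v" using gram_schmidt_hd[OF v(1), of vs, folded bv] by (simp add: ws_def)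
  then have ws0: "ws ! 0 = v" using ws(3) n by (cases ws) auto
  have W: "W \<in> carrier_mat n n" using ws(3) mat_of_cols_carrier(1)[of n ws] by (simp add: W_def)
  have colW: "col W j = ws ! j" if "j < n" for j
    using that ws by (simp add: W_def col_mat_of_cols subset_code(1))
  have cs: "ws ! j \<bullet>c ws ! i = 0 \<longleftrightarrow> i \<noteq> j" if "i < n" "j < n" for i j
    using corthogonalD[OF ws(2), of j i] ws(3) that by auto
  \<comment> \<open>Reciprocal norms of the orthogonal columns; the inner product of a vector with
    itself is real, so \<open>Re\<close> loses nothing.\<close>
  define c where "c i = 1 / sqrt (Re (ws ! i \<bullet>c ws ! i))" for i
  define U where "U = W * real_diag_mat n c"
  have U: "U \<in> carrier_mat n n" using W by (simp add: U_def mult_carrier_mat[of _ n n _ n])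
  have colU: "col U j = of_real (c j) \<cdot>\<^sub>v ws ! j" if "j < n" for j
  proof (rule eq_vecI)
    have wj: "ws ! j \<in> carrier_vec n" using ws that by auto
    then show "dim_vec (col U j) = dim_vec (of_real (c j) \<cdot>\<^sub>v ws ! j)" using U by simp
    fix i assume "i < dim_vec (of_real (c j) \<cdot>\<^sub>v ws ! j)"
    then have i: "i < n" using wj by simp
    have "W $$ (i, j) = ws ! j $ i" using colW[OF that] W i that by (metis carrier_matD index_col)
    then show "col U j $ i = (of_real (c j) \<cdot>\<^sub>v ws ! j) $ i"
      using W U wj i that index_mult_real_diag_mat[OF W i that, of c]
      by (simp add: U_def mult.commute del: index_mult_mat(1))
  qed
  have "mat_adjoint U * U = 1\<^sub>m n"
  proof (rule eq_matI)
    fix i j assume "i < dim_row (1\<^sub>m n :: complex mat)" "j < dim_col (1\<^sub>m n :: complex mat)"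
    then have ij: "i < n" "j < n" by auto
    have wc: "ws ! i \<in> carrier_vec n" "ws ! j \<in> carrier_vec n" using ws ij by auto
    have "(mat_adjoint U * U) $$ (i, j) = col U j \<bullet>c col U i"
      using U ij by (simp add: scalar_prod_def mult.commute)
    also have "\<dots> = of_real (c i) * of_real (c j) * (ws ! j \<bullet>c ws ! i)"
      using wc by (simp add: colU ij conjugate_smult_vec)
    also have "\<dots> = (1\<^sub>m n) $$ (i, j)"
    proof (cases "i = j")
      case True
      have "0 \<le> ws ! i \<bullet>c ws ! i" by (rule conjugate_square_ge_0_vec)
      then have r: "ws ! i \<bullet>c ws ! i = of_real (Re (ws ! i \<bullet>c ws ! i))" "0 \<le> Re (ws ! i \<bullet>c ws ! i)"
        by (auto simp: less_eq_complex_def complex_eq_iff)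
      moreover have "Re (ws ! i \<bullet>c ws ! i) \<noteq> 0" using cs[OF ij(1) ij(1)] r(1) by auto
      ultimately have "c i * c i * Re (ws ! i \<bullet>c ws ! i) = 1"
        by (simp add: c_def)
      then have "complex_of_real (c i * c i * Re (ws ! i \<bullet>c ws ! i)) = 1" by simp
      then show ?thesis using True ij r(1) by (metis index_one_mat(1) of_real_mult)
    qed (use cs ij in auto)
    finally show "(mat_adjoint U * U) $$ (i, j) = (1\<^sub>m n) $$ (i, j)" .
  qed (use U in auto)
  then have "U * mat_adjoint U = 1\<^sub>m n"
    using mat_mult_left_right_inverse[of "mat_adjoint U" n U] U by simp
  then show thesis
    using that[of U "of_real (c 0)"] U colU[OF n] by (simp add: unitary_mat_iff[of _ n] ws0)
qed

text \<open>Induction on the size by deflation: a unitary change of basis that starts with an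
  eigenvector splits off a real 1 by 1 block, because the first row of a Hermitian matrix mirrors
  its first column. The remaining block is again Hermitian.\<close>

theorem hermitian_mat_diagonalizable:
  assumes "A \<in> carrier_mat n n" "hermitian_mat A"
  shows "\<exists>U \<in> carrier_mat n n. \<exists>d. unitary_mat U \<and> A = diag_congruence n U d"
  using assms
proof (induction n arbitrary: A)
  case 0
  then show ?case
    by (intro bexI[of _ "1\<^sub>m 0"] exI[of _ "\<lambda>_. 0"])
      (auto simp: unitary_mat_iff[of _ 0] diag_congruence_def intro!: eq_matI)
next
  case (Suc n)
  let ?m = "Suc n"
  note assoc = assoc_mult_mat[of _ ?m ?m _ ?m _ ?m] mult_carrier_mat[of _ ?m ?m _ ?m]
  have A: "A \<in> carrier_mat ?m ?m" and Ah: "mat_adjoint A = A"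
    using Suc.prems by (auto simp: hermitian_mat_def)
  \<comment> \<open>Over the complex numbers the characteristic polynomial splits into
    \<open>Suc n\<close> linear factors, so there is at least one eigenvalue.\<close>
  obtain as where as: "char_poly A = (\<Prod>a\<leftarrow>as. [:- a, 1:])" "length as = ?m"
    using char_poly_factorized[OF A] by blast
  then obtain e es where "as = e # es" by (cases as) auto
  then have "eigenvalue A e"
    using as eigenvalue_root_char_poly[OF A, of e] by simp
  then obtain v where "v \<in> carrier_vec ?m" "v \<noteq> 0\<^sub>v ?m" and Av: "A *\<^sub>v v = e \<cdot>\<^sub>v v"
    using A by (auto simp: eigenvalue_def eigenvector_def)
  then obtain U c where U: "U \<in> carrier_mat ?m ?m" "unitary_mat U" and U0: "col U 0 = c \<cdot>\<^sub>v v"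
    using unitary_mat_with_first_col by metis
  note v = \<open>v \<in> carrier_vec ?m\<close>
  define C where "C = mat_adjoint U * A * U"
  have C: "C \<in> carrier_mat ?m ?m" using A U by (simp add: C_def assoc)
  have Ch: "mat_adjoint C = C"
    using A U Ah by (simp add: C_def mat_adjoint_mult[of _ ?m ?m _ ?m] assoc)
  have AU: "A * U \<in> carrier_mat ?m ?m" using A U by (simp add: assoc)
  have "C = mat_adjoint U * (A * U)" using A U by (simp add: C_def assoc)
  then have "col C 0 = mat_adjoint U *\<^sub>v (A *\<^sub>v col U 0)"
    using col_mult2[OF mat_adjoint_carrier[OF U(1)] AU, of 0] col_mult2[OF A U(1), of 0]
    by (simp only: zero_less_Suc)
  also have "A *\<^sub>v col U 0 = e \<cdot>\<^sub>v col U 0"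
    using A v by (simp add: U0 mult_mat_vec[of _ ?m ?m] Av smult_smult_assoc mult.commute)
  also have "mat_adjoint U *\<^sub>v (e \<cdot>\<^sub>v col U 0) = e \<cdot>\<^sub>v col (mat_adjoint U * U) 0"
    using U mult_mat_vec[OF mat_adjoint_carrier[OF U(1)], of "col U 0" e]
    by (simp add: col_carrier_vec[of 0 ?m U ?m] col_mult2[of _ ?m ?m _ ?m])
  finally have "col C 0 = e \<cdot>\<^sub>v unit_vec ?m 0"
    using unitary_matD[OF U] by simp
  then have Ci0: "C $$ (i, 0) = (if i = 0 then e else 0)" if "i < ?m" for i
    using C that by (metis (no_types, lifting) carrier_matD index_col index_smult_vec(1) index_unit_vec mult.right_neutral mult_zero_right zero_less_Suc)
  have sym: "C $$ (j, i) = cnj (C $$ (i, j))" if "i < ?m" "j < ?m" for i j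
    using C that Ch mat_adjoint_index[of j C i] by simp
  \<comment> \<open>A diagonal entry of a Hermitian matrix is its own conjugate; the coefficients of
    \<open>diag_congruence\<close> have to be real.\<close>
  have e: "e = of_real (Re e)"
    using sym[of 0 0] Ci0[of 0] by (simp add: complex_eq_iff)
  have C0j: "C $$ (0, j) = (if j = 0 then e else 0)" if "j < ?m" for j
    using sym[of j 0] Ci0[of j] that by (cases "j = 0") simp_all
  define B where "B = mat n n (\<lambda>(i, j). C $$ (Suc i, Suc j))"
  have B: "B \<in> carrier_mat n n" by (simp add: B_def)
  have "mat_adjoint B = B"
    by (rule eq_matI) (simp_all add: B_def sym[symmetric])
  then obtain V d where V: "V \<in> carrier_mat n n" "unitary_mat V" and BV: "B = diag_congruence n V d"
    using Suc.IH[OF B] by (auto simp: hermitian_mat_def)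
  \<comment> \<open>Bordering \<open>V\<close> with a 1 lets it act on the lower block and fix the
    eigenvector already split off.\<close>
  define V' where "V' = four_block_mat (1\<^sub>m 1) (0\<^sub>m 1 n) (0\<^sub>m n 1) V"
  have V'c: "V' \<in> carrier_mat ?m ?m"
    using V four_block_carrier_mat[of "1\<^sub>m 1" 1 1 V n n] by (simp add: V'_def)
  have one: "mat_adjoint (1\<^sub>m i :: complex mat) = 1\<^sub>m i" "mat_adjoint (0\<^sub>m i j :: complex mat) = 0\<^sub>m j i" for i j
    by (auto intro!: eq_matI)
  have V'a: "mat_adjoint V' = four_block_mat (1\<^sub>m 1) (0\<^sub>m 1 n) (0\<^sub>m n 1) (mat_adjoint V)"
    using V by (simp add: V'_def mat_adjoint_four_block[of _ 1 1 _ n _ n] one)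
  have "V' * mat_adjoint V' = four_block_mat (1\<^sub>m 1) (0\<^sub>m 1 n) (0\<^sub>m n 1) (1\<^sub>m n)"
    using V unitary_matD[OF V] unfolding V'a unfolding V'_def
    by (subst mult_four_block_mat[of _ 1 1 _ n _ n]) auto
  then have V'u: "unitary_mat V'" using V'c by (simp add: unitary_mat_iff[of _ ?m])
  define E where "E = mat 1 1 (\<lambda>_. e)"
  \<comment> \<open>\<open>case_nat\<close> puts the new eigenvalue at index 0 and shifts the
    eigenvalues of \<open>B\<close> by one.\<close>
  define d' where "d' = case_nat (Re e) d"
  have D: "real_diag_mat ?m d' = four_block_mat E (0\<^sub>m 1 n) (0\<^sub>m n 1) (real_diag_mat n d)"
    by (rule eq_matI) (auto simp: d'_def E_def e[symmetric] split: nat.split)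
  have "diag_congruence ?m V' d' = four_block_mat E (0\<^sub>m 1 n) (0\<^sub>m n 1) B"
    using V unfolding diag_congruence_def V'a D unfolding V'_def BV diag_congruence_def
    by (subst mult_four_block_mat[of _ 1 1 _ n _ n _ _ 1 _ n] mult_four_block_mat[of _ 1 1 _ n _ n _ _ 1 _ n];
      (simp add: E_def mult_carrier_mat[of _ n n _ n])?)+
  also have "\<dots> = C"
    by (rule eq_matI) (use C Ci0 C0j in \<open>auto simp: B_def E_def\<close>)
  finally have CV: "C = diag_congruence ?m V' d'" by simp
  have "A = (U * mat_adjoint U) * A * (U * mat_adjoint U)"
    using A by (simp add: unitary_matD[OF U])
  also have "\<dots> = U * C * mat_adjoint U"
    using A U by (simp add: C_def assoc)
  also have "\<dots> = diag_congruence ?m (U * V') d'"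
    using U V'c by (simp add: CV diag_congruence_mult_left)
  finally show ?case
    using unitary_mat_mult[OF U(1) V'c U(2) V'u] U V'c
    by (intro bexI[of _ "U * V'"] exI[of _ d']) (auto simp: mult_carrier_mat[of _ ?m ?m _ ?m])
qed

subsection \<open>Functional calculus\<close>

text \<open>The definite description in \<open>mat_fun\<close> requires independence of the
  diagonalization. For two of them, given by \<open>U\<close> and \<open>V\<close>, the matrix
  \<open>mat_adjoint V * U\<close> intertwines the two spectra entry by entry, and this relation
  survives applying \<open>f\<close> to the eigenvalues.\<close>

lemma mat_fun_diag_congruence:
  assumes U: "U \<in> carrier_mat n n" "unitary_mat U"
  shows "mat_fun f (diag_congruence n U d) = diag_congruence n U (\<lambda>i. f (d i))"
proof -
  note assoc = assoc_mult_mat[of _ n n _ n _ n] mult_carrier_mat[of _ n n _ n]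
  have unique: "diag_congruence n V (\<lambda>i. f (e i)) = diag_congruence n U (\<lambda>i. f (d i))"
    if V: "V \<in> carrier_mat n n" "unitary_mat V" and eq: "diag_congruence n U d = diag_congruence n V e"
    for V e
  proof -
    define W where "W = mat_adjoint V * U"
    have W: "W \<in> carrier_mat n n" using U V by (simp add: W_def assoc)
    have "W * real_diag_mat n d = mat_adjoint V * diag_congruence n U d * U"
      using U V unitary_matD[OF U] by (simp add: W_def diag_congruence_def assoc)
    also have "\<dots> = (mat_adjoint V * V) * real_diag_mat n e * W"
      unfolding eq using U V by (simp add: W_def diag_congruence_def assoc)
    also have "\<dots> = real_diag_mat n e * W"
      using W by (simp add: unitary_matD[OF V])
    finally have comm: "W * real_diag_mat n d = real_diag_mat n e * W" .
    have comm': "W * real_diag_mat n (\<lambda>i. f (d i)) = real_diag_mat n (\<lambda>i. f (e i)) * W"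
    proof (rule eq_matI)
      fix i j assume "i < dim_row (real_diag_mat n (\<lambda>i. f (e i)) * W)"
        "j < dim_col (real_diag_mat n (\<lambda>i. f (e i)) * W)"
      then have ij: "i < n" "j < n" using W by auto
      have "W $$ (i, j) * of_real (d j) = of_real (e i) * W $$ (i, j)"
        using arg_cong[OF comm, of "\<lambda>M. M $$ (i, j)"] W ij
        by (simp add: index_mult_real_diag_mat[where m = n] index_real_diag_mat_mult[where m = n]
            del: index_mult_mat(1))
      \<comment> \<open>A nonzero entry of \<open>W\<close> links equal eigenvalues, on which
        \<open>f\<close> agrees; a zero entry satisfies any such relation.\<close>
      then have "W $$ (i, j) = 0 \<or> d j = e i" by (auto simp: mult.commute)
      then show "(W * real_diag_mat n (\<lambda>i. f (d i))) $$ (i, j)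
          = (real_diag_mat n (\<lambda>i. f (e i)) * W) $$ (i, j)"
        using W ij
        by (auto simp: index_mult_real_diag_mat[where m = n] index_real_diag_mat_mult[where m = n]
            simp del: index_mult_mat(1))
    qed (use W in auto)
    have "diag_congruence n V (\<lambda>i. f (e i)) = diag_congruence n V (\<lambda>i. f (e i)) * (U * mat_adjoint U)"
      unfolding unitary_matD[OF U] by (simp add: right_mult_one_mat[of _ n n] V)
    also have "\<dots> = V * (real_diag_mat n (\<lambda>i. f (e i)) * W) * mat_adjoint U"
      using U V by (simp add: W_def diag_congruence_def assoc)
    also have "\<dots> = V * (W * real_diag_mat n (\<lambda>i. f (d i))) * mat_adjoint U"
      by (simp only: comm')
    also have "\<dots> = (V * mat_adjoint V) * diag_congruence n U (\<lambda>i. f (d i))"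
      using U V by (simp add: W_def diag_congruence_def assoc)
    also have "\<dots> = diag_congruence n U (\<lambda>i. f (d i))"
      unfolding unitary_matD[OF V] by (simp add: left_mult_one_mat[of _ n n] U)
    finally show ?thesis .
  qed
  have dim: "dim_row (diag_congruence n U d) = n"
    by (rule carrier_matD(1)[OF diag_congruence_carrier[OF U(1)]])
  show ?thesis
    unfolding mat_fun_def dim diag_congruence_def[symmetric]
  proof (rule the_equality)
    show "\<exists>V e. V \<in> carrier_mat n n \<and> unitary_mat V \<and> diag_congruence n U d = diag_congruence n V e
        \<and> diag_congruence n U (\<lambda>i. f (d i)) = diag_congruence n V (\<lambda>i. f (e i))"
      using U by blast
  qed (use unique in blast)
qed

subsection \<open>Congruence to real diagonal matrices\<close>

lemma invertible_matI:
  assumes "T \<in> carrier_mat n n" "S \<in> carrier_mat n n" "T * S = 1\<^sub>m n"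
  shows "invertible_mat (T :: complex mat)"
  using assms mat_mult_left_right_inverse[OF assms]
  by (auto simp: invertible_mat_def inverts_mat_def)

lemma invertible_matE:
  assumes "T \<in> carrier_mat n n" "invertible_mat (T :: complex mat)"
  obtains S where "S \<in> carrier_mat n n" "T * S = 1\<^sub>m n" "S * T = 1\<^sub>m n"
proof -
  from assms(2) obtain S where "T * S = 1\<^sub>m (dim_row T)" "S * T = 1\<^sub>m (dim_row S)"
    by (auto simp: invertible_mat_def inverts_mat_def)
  then have *: "T * S = 1\<^sub>m n" "S * T = 1\<^sub>m (dim_row S)" using assms(1) by auto
  \<comment> \<open>Column counts on both sides fix the dimensions of \<open>S\<close>, which
    \<open>invertible_mat\<close> leaves open.\<close>
  have "dim_col S = n" using arg_cong[OF *(1), of dim_col] by simp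
  moreover have "dim_row S = n" using arg_cong[OF *(2), of dim_col] assms(1) by simp
  ultimately show thesis using that[of S] * by auto
qed

lemma unitary_mat_invertible:
  assumes "U \<in> carrier_mat n n" "unitary_mat U"
  shows "invertible_mat U"
  using invertible_matI[OF assms(1) mat_adjoint_carrier[OF assms(1)]] unitary_matD[OF assms] by simp

lemma mult_mat_zero_vec: "A \<in> carrier_mat n m \<Longrightarrow> A *\<^sub>v 0\<^sub>v m = 0\<^sub>v n"
  by (rule eq_vecI) auto

text \<open>With \<open>S\<close> inverse to \<open>T\<close>, take the image of the
  \<open>i\<close>-th unit vector under \<open>mat_adjoint S\<close>: \<open>mat_adjoint T\<close>
  sends it back to that unit vector, so the sum of squares collapses to one coefficient. One vector
  serves all \<open>a\<close>.\<close>

lemma quadratic_form_coordinate: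
  assumes T: "T \<in> carrier_mat n n" "invertible_mat T" and "i < n"
  obtains v where "v \<in> carrier_vec n" "v \<noteq> 0\<^sub>v n"
    "\<And>a. (diag_congruence n T a *\<^sub>v v) \<bullet>c v = complex_of_real (a i)"
proof -
  obtain S where S: "S \<in> carrier_mat n n" "S * T = 1\<^sub>m n"
    using invertible_matE[OF T] by metis
  define v where "v = mat_adjoint S *\<^sub>v unit_vec n i"
  have v: "v \<in> carrier_vec n" using S by (simp add: v_def mult_mat_vec_carrier[of _ n n])
  have "mat_adjoint T * mat_adjoint S = mat_adjoint (1\<^sub>m n)"
    using S T(1) mat_adjoint_mult[of S n n T n] by simp
  also have "\<dots> = 1\<^sub>m n" by (auto intro!: eq_matI)
  finally have Tv: "mat_adjoint T *\<^sub>v v = unit_vec n i"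
    using S T by (simp add: v_def flip: assoc_mult_mat_vec[of _ n n _ n])
  have "v \<noteq> 0\<^sub>v n"
  proof
    assume "v = 0\<^sub>v n"
    then have "unit_vec n i = (0\<^sub>v n :: complex vec)" using Tv T by (metis mat_adjoint_carrier mult_mat_zero_vec)
    then show False using \<open>i < n\<close> by (metis index_unit_vec(1) index_zero_vec(1) zero_neq_one)
  qed
  moreover have "(\<Sum>k<n. a k * (cmod (unit_vec n i $ k))\<^sup>2) = a i" for a
    using \<open>i < n\<close> by (simp add: index_unit_vec if_distrib cong: if_cong)
      (subst sum.mono_neutral_right[of _ "{i}"], auto)
  ultimately show thesis
    using that[OF v] by (simp add: diag_congruence_quadratic_form[OF T(1) v] Tv)
qed

text \<open>The signs of the coefficients are invariant under congruence, as in Sylvester's law of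
  inertia: test vectors isolate each coefficient, and conversely the form is a sum of nonnegative
  terms.\<close>

lemma pos_semidef_diag_congruence_iff:
  assumes T: "T \<in> carrier_mat n n" "invertible_mat T"
  shows "pos_semidef_mat (diag_congruence n T a) \<longleftrightarrow> (\<forall>i<n. 0 \<le> a i)"
proof
  assume L: "pos_semidef_mat (diag_congruence n T a)"
  show "\<forall>i<n. 0 \<le> a i"
  proof (intro allI impI)
    fix i assume "i < n"
    from quadratic_form_coordinate[OF T this] obtain v where "v \<in> carrier_vec n"
      "(diag_congruence n T a *\<^sub>v v) \<bullet>c v = complex_of_real (a i)" by metis
    then have "0 \<le> complex_of_real (a i)"
      using L carrier_matD[OF diag_congruence_carrier[OF T(1), of a]]
      by (metis pos_semidef_mat_def)
    then show "0 \<le> a i" by (simp add: less_eq_complex_def)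
  qed
next
  assume "\<forall>i<n. 0 \<le> a i"
  then show "pos_semidef_mat (diag_congruence n T a)"
    using carrier_matD[OF diag_congruence_carrier[OF T(1), of a]]
    by (auto simp: pos_semidef_mat_def diag_congruence_hermitian[OF T(1)]
       diag_congruence_quadratic_form[OF T(1)] less_eq_complex_def intro!: sum_nonneg)
qed

lemma pos_def_diag_congruence_iff:
  assumes T: "T \<in> carrier_mat n n" "invertible_mat T"
  shows "pos_def_mat (diag_congruence n T a) \<longleftrightarrow> (\<forall>i<n. 0 < a i)"
proof
  assume L: "pos_def_mat (diag_congruence n T a)"
  show "\<forall>i<n. 0 < a i"
  proof (intro allI impI)
    fix i assume "i < n"
    from quadratic_form_coordinate[OF T this] obtain v where "v \<in> carrier_vec n" "v \<noteq> 0\<^sub>v n"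
      "(diag_congruence n T a *\<^sub>v v) \<bullet>c v = complex_of_real (a i)" by metis
    then have "0 < complex_of_real (a i)"
      using L carrier_matD[OF diag_congruence_carrier[OF T(1), of a]]
      by (metis pos_def_mat_def)
    then show "0 < a i" by (simp add: less_complex_def)
  qed
next
  assume a: "\<forall>i<n. 0 < a i"
  have "0 < (diag_congruence n T a *\<^sub>v v) \<bullet>c v" if v: "v \<in> carrier_vec n" "v \<noteq> 0\<^sub>v n" for v
  proof -
    define w where "w = mat_adjoint T *\<^sub>v v"
    have w: "w \<in> carrier_vec n" using T v by (simp add: w_def mult_mat_vec_carrier[of _ n n])
    obtain S where S: "S \<in> carrier_mat n n" "T * S = 1\<^sub>m n"
      using invertible_matE[OF T] by metis
    have "mat_adjoint S * mat_adjoint T = mat_adjoint (1\<^sub>m n)"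
      using S T(1) mat_adjoint_mult[of T n n S n] by simp
    also have "\<dots> = 1\<^sub>m n" by (auto intro!: eq_matI)
    finally have "mat_adjoint S *\<^sub>v w = v"
      using S T v by (simp add: w_def flip: assoc_mult_mat_vec[of _ n n _ n])
    then have "w \<noteq> 0\<^sub>v n" using v S by (metis mat_adjoint_carrier mult_mat_zero_vec)
    then obtain k where k: "k < n" "w $ k \<noteq> 0"
      using w by (metis carrier_vecD eq_vecI index_zero_vec)
    \<comment> \<open>Invertibility of \<open>T\<close> has made some coordinate of \<open>w\<close>
      nonzero; its term makes the sum strictly positive.\<close>
    have "0 < (\<Sum>k<n. a k * (cmod (w $ k))\<^sup>2)"
      using a k by (intro sum_pos2[of _ k]) (auto simp: less_imp_le)
    then show ?thesis
      by (simp add: diag_congruence_quadratic_form[OF T(1) v(1)] w_def less_complex_def)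
  qed
  then show "pos_def_mat (diag_congruence n T a)"
    using carrier_matD[OF diag_congruence_carrier[OF T(1), of a]]
    by (auto simp: pos_def_mat_def diag_congruence_hermitian[OF T(1)])
qed

text \<open>The difference is again a congruence by \<open>T\<close>, so its positivity is read off
  the coefficients. This is the passage between matrix and scalar inequalities.\<close>

lemma loewner_le_diag_congruence_iff:
  assumes T: "T \<in> carrier_mat n n" "invertible_mat T"
  shows "diag_congruence n T a \<le>\<^sub>L diag_congruence n T b \<longleftrightarrow> (\<forall>i<n. a i \<le> b i)"
  using carrier_matD[OF diag_congruence_carrier[OF T(1)]]
  by (simp add: loewner_le_def diag_congruence_hermitian[OF T(1)] diag_congruence_minus[OF T(1)]
      pos_semidef_diag_congruence_iff[OF T])

text \<open>Reduce \<open>A\<close> to the identity by a congruence, then diagonalize what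
  \<open>B\<close> has become by a unitary, which leaves the identity unchanged.\<close>

lemma simultaneous_diag_congruence:
  assumes A: "A \<in> carrier_mat n n" "pos_def_mat A" and B: "B \<in> carrier_mat n n" "hermitian_mat B"
  obtains T b where "T \<in> carrier_mat n n" "invertible_mat T"
    "A = diag_congruence n T (\<lambda>i. 1)" "B = diag_congruence n T b"
proof -
  note assoc = assoc_mult_mat[of _ n n _ n _ n] mult_carrier_mat[of _ n n _ n]
  obtain U d where U: "U \<in> carrier_mat n n" "unitary_mat U" and AU: "A = diag_congruence n U d"
    using hermitian_mat_diagonalizable A by (metis pos_def_mat_def)
  have d: "0 < d i" if "i < n" for i
    using A(2) that unfolding AU pos_def_diag_congruence_iff[OF U(1) unitary_mat_invertible[OF U]]
    by blast
  \<comment> \<open>\<open>R\<close> factors \<open>A\<close> as \<open>R * mat_adjoint R\<close>,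
    and \<open>S\<close> is its inverse; the reciprocal roots exist because the eigenvalues are
    positive.\<close>
  define R where "R = U * real_diag_mat n (\<lambda>i. sqrt (d i))"
  define S where "S = real_diag_mat n (\<lambda>i. 1 / sqrt (d i)) * mat_adjoint U"
  have RS: "R \<in> carrier_mat n n" "S \<in> carrier_mat n n"
    using U by (simp_all add: R_def S_def assoc)
  have "real_diag_mat n (\<lambda>i. sqrt (d i)) * real_diag_mat n (\<lambda>i. 1 / sqrt (d i)) = 1\<^sub>m n"
    unfolding real_diag_mat_mult using d by (intro eq_matI) (auto simp: less_imp_neq[symmetric])
  moreover have "R * S = U * (real_diag_mat n (\<lambda>i. sqrt (d i)) * real_diag_mat n (\<lambda>i. 1 / sqrt (d i))) * mat_adjoint U"
    using U by (simp add: R_def S_def assoc)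
  ultimately have "R * S = U * 1\<^sub>m n * mat_adjoint U"
    by simp
  then have RS1: "R * S = 1\<^sub>m n"
    using U by (simp add: unitary_matD[OF U] right_mult_one_mat[of _ n n])
  have SR: "mat_adjoint S * mat_adjoint R = 1\<^sub>m n"
    using arg_cong[OF RS1, of mat_adjoint] RS by (simp add: mat_adjoint_mult[of _ n n _ n])
      (auto intro!: eq_matI)
  have AR: "A = diag_congruence n R (\<lambda>i. 1)"
    unfolding AU R_def diag_congruence_mult_diag[OF U(1)]
    using d by (intro diag_congruence_cong) (simp add: less_imp_le)
  define C where "C = S * B * mat_adjoint S"
  have C: "C \<in> carrier_mat n n" using RS B by (simp add: C_def assoc)
  have "mat_adjoint C = C"
    using RS B by (simp add: C_def hermitian_mat_def mat_adjoint_mult[of _ n n _ n] assoc)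
  then obtain V b where V: "V \<in> carrier_mat n n" "unitary_mat V" and CV: "C = diag_congruence n V b"
    using hermitian_mat_diagonalizable[OF C] by (auto simp: hermitian_mat_def)
  define T where "T = R * V"
  have T: "T \<in> carrier_mat n n" using RS V by (simp add: T_def assoc)
  have "T * (mat_adjoint V * S) = R * (V * mat_adjoint V) * S"
    using RS V by (simp add: T_def assoc)
  also have "\<dots> = 1\<^sub>m n" using RS RS1 by (simp add: unitary_matD[OF V] right_mult_one_mat[of _ n n])
  finally have "invertible_mat T"
    using RS V T by (intro invertible_matI[of _ n "mat_adjoint V * S"]) (simp_all add: assoc)
  moreover have "A = diag_congruence n T (\<lambda>i. 1)"
  proof -
    have "diag_congruence n T (\<lambda>i. 1) = R * diag_congruence n V (\<lambda>i. 1) * mat_adjoint R"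
      using RS V by (simp add: T_def diag_congruence_mult_left)
    also have "diag_congruence n V (\<lambda>i. 1) = real_diag_mat n (\<lambda>i. 1)"
      by (simp only: diag_congruence_one[OF V] real_diag_mat_one)
    finally show ?thesis by (simp add: AR diag_congruence_def)
  qed
  moreover have "B = diag_congruence n T b"
  proof -
    have "diag_congruence n T b = R * C * mat_adjoint R"
      using RS V by (simp add: T_def diag_congruence_mult_left CV)
    also have "\<dots> = (R * S) * B * (mat_adjoint S * mat_adjoint R)"
      using RS B by (simp add: C_def assoc)
    finally show ?thesis using B by (simp add: RS1 SR)
  qed
  ultimately show thesis using that T by blast
qed

text \<open>
  Congruence invariance of the geometric mean. If \<open>A = T diag(a) T\<^sup>*\<close>, then
  \<open>V = A\<^sup>-\<^sup>1\<^sup>/\<^sup>2 T diag(a)\<^sup>1\<^sup>/\<^sup>2\<close> is unitary and diagonalizes \<open>A\<^sup>-\<^sup>1\<^sup>/\<^sup>2 B A\<^sup>-\<^sup>1\<^sup>/\<^sup>2\<close>.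
\<close>
lemma geom_mean_diag_congruence:
  assumes T: "T \<in> carrier_mat n n" "invertible_mat T"
    and ab: "\<And>i. i < n \<Longrightarrow> 0 < a i" "\<And>i. i < n \<Longrightarrow> 0 < b i"
  shows "diag_congruence n T a \<sharp>\<^bsub>t\<^esub> diag_congruence n T b
    = diag_congruence n T (\<lambda>i. a i * (b i / a i) powr t)"
proof -
  note assoc = assoc_mult_mat[of _ n n _ n _ n] mult_carrier_mat[of _ n n _ n]
  define A where "A = diag_congruence n T a"
  define B where "B = diag_congruence n T b"
  have AB: "A \<in> carrier_mat n n" "B \<in> carrier_mat n n" using T by (simp_all add: A_def B_def)
  have "hermitian_mat A" by (simp add: A_def diag_congruence_hermitian T)
  then obtain U d where U: "U \<in> carrier_mat n n" "unitary_mat U" and AU: "A = diag_congruence n U d"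
    using hermitian_mat_diagonalizable AB by metis
  have "pos_def_mat A"
    using ab unfolding A_def pos_def_diag_congruence_iff[OF T] by blast
  then have d: "0 < d i" if "i < n" for i
    using that unfolding AU pos_def_diag_congruence_iff[OF U(1) unitary_mat_invertible[OF U]]
    by blast
  define R where "R = diag_congruence n U (\<lambda>i. d i powr (1/2))"
  define Q where "Q = diag_congruence n U (\<lambda>i. d i powr (-1/2))"
  have RQ: "R \<in> carrier_mat n n" "Q \<in> carrier_mat n n" using U by (simp_all add: R_def Q_def)
  have powr: "mat_powr A (1/2) = R" "mat_powr A (-1/2) = Q"
    by (simp_all add: mat_powr_def AU mat_fun_diag_congruence[OF U] R_def Q_def)
  have adj: "mat_adjoint R = R" "mat_adjoint Q = Q"
    using diag_congruence_hermitian[OF U(1)] by (simp_all add: R_def Q_def hermitian_mat_def)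
  \<comment> \<open>The inner factor \<open>mat_adjoint U * U\<close> cancels, so matrices diagonal
    in one orthonormal basis multiply through their eigenvalues.\<close>
  have mult: "diag_congruence n U x * diag_congruence n U y = diag_congruence n U (\<lambda>i. x i * y i)" for x y
  proof -
    have "diag_congruence n U x * diag_congruence n U y
        = U * real_diag_mat n x * (mat_adjoint U * U) * real_diag_mat n y * mat_adjoint U"
      using U by (simp add: diag_congruence_def assoc)
    also have "\<dots> = U * (real_diag_mat n x * real_diag_mat n y) * mat_adjoint U"
      using U by (simp add: unitary_matD[OF U] right_mult_one_mat[of _ n n] assoc)
    finally show ?thesis by (simp add: real_diag_mat_mult diag_congruence_def)
  qed
  note one = diag_congruence_one[OF U]
  have QAQ: "Q * A * Q = 1\<^sub>m n"
    unfolding Q_def AU mult one[symmetric]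
  proof (rule diag_congruence_cong)
    fix i assume "i < n"
    then show "d i powr (-1/2) * d i * d i powr (-1/2) = 1"
      using d[of i] by (simp add: field_simps powr_minus flip: powr_add)
  qed
  have RQ1: "R * Q = 1\<^sub>m n"
    unfolding Q_def R_def mult one[symmetric] using d
    by (intro diag_congruence_cong) (simp add: less_imp_neq[symmetric] flip: powr_add)
  \<comment> \<open>Absorbing the square roots of \<open>a\<close> into the congruence gives
    \<open>D * mat_adjoint D = A\<close>; relative to \<open>D\<close> the coefficients of
    \<open>B\<close> are the ratios \<open>b i / a i\<close>.\<close>
  define D where "D = T * real_diag_mat n (\<lambda>i. sqrt (a i))"
  have D: "D \<in> carrier_mat n n" using T by (simp add: D_def assoc)
  have cD: "diag_congruence n D h = diag_congruence n T (\<lambda>i. a i * h i)" for h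
    unfolding D_def diag_congruence_mult_diag[OF T(1)] using ab(1)
    by (intro diag_congruence_cong) (simp add: less_imp_le)
  define V where "V = Q * D"
  have V: "V \<in> carrier_mat n n" using RQ D by (simp add: V_def assoc)
  have cV: "diag_congruence n V h = Q * diag_congruence n T (\<lambda>i. a i * h i) * Q" for h
    using RQ D by (simp add: V_def diag_congruence_mult_left cD adj)
  have "V * mat_adjoint V = diag_congruence n V (\<lambda>i. 1)"
    using V by (simp add: diag_congruence_def real_diag_mat_one right_mult_one_mat[of _ n n])
  then have "V * mat_adjoint V = 1\<^sub>m n"
    by (simp add: cV QAQ flip: A_def)
  then have Vu: "unitary_mat V" using V by (simp add: unitary_mat_iff[of _ n])
  have "diag_congruence n T (\<lambda>i. a i * (b i / a i)) = B"
    unfolding B_def using ab(1) by (intro diag_congruence_cong) (simp add: less_imp_neq[symmetric])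
  then have "Q * B * Q = diag_congruence n V (\<lambda>i. b i / a i)"
    by (simp add: cV)
  then have "mat_powr (Q * B * Q) t = diag_congruence n V (\<lambda>i. (b i / a i) powr t)"
    by (simp add: mat_powr_def mat_fun_diag_congruence[OF V Vu])
  then have "A \<sharp>\<^bsub>t\<^esub> B = R * diag_congruence n V (\<lambda>i. (b i / a i) powr t) * R"
    by (simp only: geom_mean_def powr)
  also have "\<dots> = diag_congruence n (R * V) (\<lambda>i. (b i / a i) powr t)"
    using RQ V by (simp add: diag_congruence_mult_left adj)
  \<comment> \<open>The outer square root undoes the \<open>Q\<close> inside \<open>V\<close>, so
    the spectral basis of \<open>A\<close> disappears from the result.\<close>
  also have "R * V = (R * Q) * D"
    using RQ D by (simp add: V_def assoc)
  also have "\<dots> = D" using D by (simp add: RQ1)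
  finally show ?thesis by (simp add: cD A_def B_def)
qed

subsection \<open>The Loewner order\<close>

lemma hermitian_mat_quadratic_form_real:
  assumes "A \<in> carrier_mat n n" "hermitian_mat A" "v \<in> carrier_vec n"
  shows "Im ((A *\<^sub>v v) \<bullet>c v) = 0"
proof -
  obtain U d where "U \<in> carrier_mat n n" "A = diag_congruence n U d"
    using hermitian_mat_diagonalizable[OF assms(1,2)] by blast
  then show ?thesis using assms(3) by (simp add: diag_congruence_quadratic_form)
qed

lemma hermitian_mat_minus:
  assumes "A \<in> carrier_mat n n" "B \<in> carrier_mat n n" "hermitian_mat A" "hermitian_mat B"
  shows "hermitian_mat (B - A)"
  unfolding hermitian_mat_def
proof (rule eq_matI)
  fix i j assume "i < dim_row (B - A)" "j < dim_col (B - A)"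
  then have ij: "i < n" "j < n" using assms(1) by simp_all
  have "conjugate (A $$ (j, i)) = A $$ (i, j)" "conjugate (B $$ (j, i)) = B $$ (i, j)"
    using assms ij mat_adjoint_index unfolding hermitian_mat_def by (metis carrier_matD)+
  then show "mat_adjoint (B - A) $$ (i, j) = (B - A) $$ (i, j)"
    using assms(1,2) ij by simp
qed (use assms(1,2) in simp_all)

text \<open>Hermitian forms are real-valued, so the order becomes a family of real inequalities.
  Transitivity and passage to limits are then inherited from the reals, also for matrices with
  different eigenvectors.\<close>

lemma loewner_le_iff_quadratic_form:
  assumes A: "A \<in> carrier_mat n n" and B: "B \<in> carrier_mat n n"
  shows "A \<le>\<^sub>L B \<longleftrightarrow> hermitian_mat A \<and> hermitian_mat B \<and>
    (\<forall>v \<in> carrier_vec n. Re ((A *\<^sub>v v) \<bullet>c v) \<le> Re ((B *\<^sub>v v) \<bullet>c v))"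
proof -
  have "0 \<le> ((B - A) *\<^sub>v v) \<bullet>c v \<longleftrightarrow> Re ((A *\<^sub>v v) \<bullet>c v) \<le> Re ((B *\<^sub>v v) \<bullet>c v)"
    if "hermitian_mat A" "hermitian_mat B" "v \<in> carrier_vec n" for v
  proof -
    have "((B - A) *\<^sub>v v) \<bullet>c v = (B *\<^sub>v v) \<bullet>c v - (A *\<^sub>v v) \<bullet>c v"
      using A B that(3)
      by (simp add: minus_mult_distrib_mat_vec[of _ n n] minus_scalar_prod_distrib[of _ n]
          mult_mat_vec_carrier[of _ n n])
    then show ?thesis
      using hermitian_mat_quadratic_form_real[OF A that(1,3)]
        hermitian_mat_quadratic_form_real[OF B that(2,3)]
      by (simp add: less_eq_complex_def)
  qed
  moreover have "dim_row A = n" "dim_row B = n" "dim_row (B - A) = n" using A B by simp_all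
  ultimately show ?thesis
    using hermitian_mat_minus[OF A B]
    by (auto simp: loewner_le_def pos_semidef_mat_def simp del: index_minus_mat)
qed

lemma loewner_le_trans:
  assumes "A \<in> carrier_mat n n" "B \<in> carrier_mat n n" "C \<in> carrier_mat n n"
    and "A \<le>\<^sub>L B" "B \<le>\<^sub>L C"
  shows "A \<le>\<^sub>L C"
  using assms(4,5) unfolding loewner_le_iff_quadratic_form[OF assms(1,2)]
    loewner_le_iff_quadratic_form[OF assms(2,3)] loewner_le_iff_quadratic_form[OF assms(1,3)]
  by (meson order_trans)

lemma mat_fun_carrier:
  assumes "A \<in> carrier_mat n n" "hermitian_mat A"
  shows "mat_fun f A \<in> carrier_mat n n"
proof -
  obtain U d where "U \<in> carrier_mat n n" "unitary_mat U" "A = diag_congruence n U d"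
    using hermitian_mat_diagonalizable[OF assms] by blast
  then show ?thesis by (simp add: mat_fun_diag_congruence)
qed

section \<open>Means that act entrywise after a common congruence\<close>

text \<open>\<open>p\<close> is the representing function of the mean \<open>M\<close>: on scalars, \<open>M a b = a p(b/a)\<close>.\<close>
definition entrywise_mean :: "(real \<Rightarrow> real) \<Rightarrow> (complex mat \<Rightarrow> complex mat \<Rightarrow> complex mat) \<Rightarrow> bool" where
  "entrywise_mean p M \<longleftrightarrow>
    (\<forall>n. \<forall>T \<in> carrier_mat n n. \<forall>a b. invertible_mat T \<longrightarrow> (\<forall>i<n. 0 < a i \<and> 0 < b i) \<longrightarrow>
      M (diag_congruence n T a) (diag_congruence n T b)
        = diag_congruence n T (\<lambda>i. a i * p (b i / a i)))"

lemma entrywise_meanD: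
  assumes "entrywise_mean p M" "T \<in> carrier_mat n n" "invertible_mat T"
    "\<And>i. i < n \<Longrightarrow> 0 < a i" "\<And>i. i < n \<Longrightarrow> 0 < b i"
  shows "M (diag_congruence n T a) (diag_congruence n T b)
    = diag_congruence n T (\<lambda>i. a i * p (b i / a i))"
  using assms by (auto simp: entrywise_mean_def)

lemma entrywise_mean_geom_mean: "entrywise_mean (\<lambda>x. x powr t) (\<lambda>A B. A \<sharp>\<^bsub>t\<^esub> B)"
  by (simp add: entrywise_mean_def geom_mean_diag_congruence)

lemma entrywise_mean_add: "entrywise_mean (\<lambda>x. 1 + x) (+)"
  unfolding entrywise_mean_def
  by (auto simp: diag_congruence_add field_simps intro!: diag_congruence_cong)

lemma entrywise_mean_sum:
  assumes "entrywise_mean p M" "entrywise_mean q N"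
  shows "entrywise_mean (\<lambda>x. p x + q x) (\<lambda>A B. M A B + N A B)"
  using assms by (simp add: entrywise_mean_def diag_congruence_add distrib_left)

lemma entrywise_mean_smult:
  assumes "entrywise_mean p M"
  shows "entrywise_mean (\<lambda>x. c * p x) (\<lambda>A B. complex_of_real c \<cdot>\<^sub>m M A B)"
  using assms by (simp add: entrywise_mean_def diag_congruence_smult mult.left_commute)

subsection \<open>Operator monotonicity from comparisons of means\<close>

text \<open>Adding a positive multiple of the identity makes both matrices positive definite and
  preserves their difference. The eigenvectors stay fixed as the shift tends to 0, so continuity of
  \<open>f\<close> on the closed half-line makes the quadratic forms converge.\<close>

lemma operator_monotone_if_pos_def:
  assumes f: "continuous_on {0..} f"
    and pd: "\<And>n X Y. X \<in> carrier_mat n n \<Longrightarrow> Y \<in> carrier_mat n n \<Longrightarrow> pos_def_mat X \<Longrightarrow>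
      pos_def_mat Y \<Longrightarrow> X \<le>\<^sub>L Y \<Longrightarrow> mat_fun f X \<le>\<^sub>L mat_fun f Y"
  shows "operator_monotone f"
  unfolding operator_monotone_def
proof (intro allI ballI impI)
  fix n X Y
  assume X: "X \<in> carrier_mat n n" "pos_semidef_mat X" and Y: "Y \<in> carrier_mat n n" "pos_semidef_mat Y"
    and XY: "X \<le>\<^sub>L Y"
  obtain U d where U: "U \<in> carrier_mat n n" "unitary_mat U" and XU: "X = diag_congruence n U d"
    using hermitian_mat_diagonalizable X by (metis pos_semidef_mat_def)
  obtain V e where V: "V \<in> carrier_mat n n" "unitary_mat V" and YV: "Y = diag_congruence n V e"
    using hermitian_mat_diagonalizable Y by (metis pos_semidef_mat_def)
  note Ui = U(1) unitary_mat_invertible[OF U] and Vi = V(1) unitary_mat_invertible[OF V]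
  have d: "\<forall>i<n. 0 \<le> d i" using X(2) unfolding XU pos_semidef_diag_congruence_iff[OF Ui] .
  have e: "\<forall>i<n. 0 \<le> e i" using Y(2) unfolding YV pos_semidef_diag_congruence_iff[OF Vi] .
  \<comment> \<open>Constant coefficients in a unitary congruence give a scalar matrix, the same for
    \<open>U\<close> and \<open>V\<close>; hence both shifts add one and the same matrix.\<close>
  have scalar: "diag_congruence n W (\<lambda>i. c) = complex_of_real c \<cdot>\<^sub>m 1\<^sub>m n"
    if "W \<in> carrier_mat n n" "unitary_mat W" for W c
  proof -
    have "diag_congruence n W (\<lambda>i. c) = complex_of_real c \<cdot>\<^sub>m diag_congruence n W (\<lambda>i. 1)"
      using that(1) by (simp add: diag_congruence_smult)
    then show ?thesis by (simp only: diag_congruence_one[OF that])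
  qed
  have shift: "mat_fun f (diag_congruence n U (\<lambda>i. d i + c)) \<le>\<^sub>L mat_fun f (diag_congruence n V (\<lambda>i. e i + c))"
    if "0 < c" for c
  proof (rule pd[where n = n])
    have sum: "diag_congruence n U (\<lambda>i. d i + c) = X + complex_of_real c \<cdot>\<^sub>m 1\<^sub>m n"
      "diag_congruence n V (\<lambda>i. e i + c) = Y + complex_of_real c \<cdot>\<^sub>m 1\<^sub>m n"
      by (simp_all only: XU scalar[OF U, symmetric] diag_congruence_add[OF U(1)])
        (simp_all only: YV scalar[OF U] scalar[OF V, symmetric] diag_congruence_add[OF V(1)])
    have "diag_congruence n V (\<lambda>i. e i + c) - diag_congruence n U (\<lambda>i. d i + c) = Y - X"
      unfolding sum by (rule eq_matI) (use X(1) Y(1) in simp_all)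
    then show "diag_congruence n U (\<lambda>i. d i + c) \<le>\<^sub>L diag_congruence n V (\<lambda>i. e i + c)"
      using XY U V carrier_matD[OF diag_congruence_carrier[OF U(1)]]
        carrier_matD[OF diag_congruence_carrier[OF V(1)]]
      by (simp add: loewner_le_def diag_congruence_hermitian)
    show "pos_def_mat (diag_congruence n U (\<lambda>i. d i + c))"
      using d that by (simp add: pos_def_diag_congruence_iff[OF Ui] add_nonneg_pos)
    show "pos_def_mat (diag_congruence n V (\<lambda>i. e i + c))"
      using e that by (simp add: pos_def_diag_congruence_iff[OF Vi] add_nonneg_pos)
  qed (use U V in simp_all)
  define Q where "Q W a v = (\<Sum>k<n. a k * (cmod ((mat_adjoint W *\<^sub>v v) $ k))\<^sup>2)" for W a v
  \<comment> \<open>The shifts \<open>1 / real (Suc m)\<close> are positive, as the positive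
    definite case demands, and keep the arguments where \<open>f\<close> is continuous.\<close>
  have Q_lim: "(\<lambda>m. Q W (\<lambda>i. f (a i + 1 / real (Suc m))) v) \<longlonglongrightarrow> Q W (\<lambda>i. f (a i)) v"
    if a: "\<forall>i<n. 0 \<le> a i" for W a v
    unfolding Q_def
  proof (intro tendsto_sum tendsto_mult tendsto_const)
    fix k assume "k \<in> {..<n}"
    then have "0 \<le> a k" using a by simp
    moreover have "(\<lambda>m. a k + 1 / real (Suc m)) \<longlonglongrightarrow> a k"
      using LIMSEQ_inverse_real_of_nat_add[of "a k"] by (simp only: inverse_eq_divide)
    ultimately show "(\<lambda>m. f (a k + 1 / real (Suc m))) \<longlonglongrightarrow> f (a k)"
      by (intro continuous_on_tendsto_compose[OF f]) (auto intro!: always_eventually add_nonneg_nonneg)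
  qed
  have Q_le: "Q U (\<lambda>i. f (d i + c)) v \<le> Q V (\<lambda>i. f (e i + c)) v" if "v \<in> carrier_vec n" "0 < c" for v c
    using shift[OF that(2)] that(1) U V
    by (simp add: mat_fun_diag_congruence loewner_le_iff_quadratic_form[of _ n]
        diag_congruence_quadratic_form Q_def)
  have "Q U (\<lambda>i. f (d i)) v \<le> Q V (\<lambda>i. f (e i)) v" if "v \<in> carrier_vec n" for v
    by (rule LIMSEQ_le[OF Q_lim[OF d] Q_lim[OF e]]) (use Q_le[OF that] in auto)
  then show "mat_fun f X \<le>\<^sub>L mat_fun f Y"
    using U V
    by (simp add: XU YV mat_fun_diag_congruence loewner_le_iff_quadratic_form[of _ n]
        diag_congruence_quadratic_form diag_congruence_hermitian Q_def)
qed

text \<open>Each equivalence of the theorem is one instance, for two neighbouring means. Equality at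
  1 and strictness at \<open>x0\<close> let the quotient \<open>q / p\<close> sweep an interval to
  the right of 1.\<close>

theorem operator_monotone_iff_mean_comparison:
  assumes f: "continuous_on {0..} f"
    and M: "entrywise_mean p M" and N: "entrywise_mean q N"
    and cont: "continuous_on {0<..} p" "continuous_on {0<..} q"
    and pos: "\<And>x. 0 < x \<Longrightarrow> 0 < p x" and le: "\<And>x. 0 < x \<Longrightarrow> p x \<le> q x"
    and eq: "p 1 = q 1" and strict: "0 < x0" "p x0 < q x0"
  shows "operator_monotone f \<longleftrightarrow>
    (\<forall>n. \<forall>A \<in> carrier_mat n n. \<forall>B \<in> carrier_mat n n. pos_def_mat A \<longrightarrow> pos_def_mat B \<longrightarrow>
      mat_fun f (M A B) \<le>\<^sub>L mat_fun f (N A B))" (is "?L \<longleftrightarrow> ?R")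
proof
  assume mono: ?L
  show ?R
  proof (intro allI ballI impI)
    fix n A B assume A: "A \<in> carrier_mat n n" "pos_def_mat A" and B: "B \<in> carrier_mat n n" "pos_def_mat B"
    from B(2) have "hermitian_mat B" by (simp add: pos_def_mat_def)
    then obtain T b where T: "T \<in> carrier_mat n n" "invertible_mat T"
      and AT: "A = diag_congruence n T (\<lambda>i. 1)" and BT: "B = diag_congruence n T b"
      using simultaneous_diag_congruence A B(1) by metis
    have b: "0 < b i" if "i < n" for i
      using B(2) that unfolding BT pos_def_diag_congruence_iff[OF T] by blast
    \<comment> \<open>The coefficients of \<open>A\<close> are 1, so those of \<open>B\<close> are
      the ratios at which the representing functions are evaluated.\<close>
    have MN: "M A B = diag_congruence n T (\<lambda>i. p (b i))" "N A B = diag_congruence n T (\<lambda>i. q (b i))"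
      using entrywise_meanD[OF M T, of "\<lambda>i. 1" b] entrywise_meanD[OF N T, of "\<lambda>i. 1" b] b
      by (simp_all add: AT BT)
    have "0 \<le> p (b i)" "p (b i) \<le> q (b i)" "0 \<le> q (b i)" if "i < n" for i
      using pos[OF b[OF that]] le[OF b[OF that]] by simp_all
    then have "pos_semidef_mat (M A B)" "pos_semidef_mat (N A B)" "M A B \<le>\<^sub>L N A B"
      by (auto simp: MN pos_semidef_diag_congruence_iff[OF T] loewner_le_diag_congruence_iff[OF T])
    moreover have "M A B \<in> carrier_mat n n" "N A B \<in> carrier_mat n n"
      by (simp_all add: MN T)
    ultimately show "mat_fun f (M A B) \<le>\<^sub>L mat_fun f (N A B)"
      using mono by (simp add: operator_monotone_def)
  qed
next
  assume cmp: ?R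
  define r where "r = q x0 / p x0"
  have r: "1 < r" using pos[OF strict(1)] strict(2) by (simp add: r_def)
  \<comment> \<open>Intermediate value theorem: the image of the half-line under
    \<open>q / p\<close> is connected and contains 1, attained at 1, and \<open>r\<close>, attained
    at \<open>x0\<close>.\<close>
  have "\<exists>c>0. q c = z * p c" if "1 \<le> z" "z \<le> r" for z
  proof -
    have "continuous_on {0<..} (\<lambda>x. q x / p x)"
      using pos by (intro continuous_on_divide cont) (metis greaterThan_iff less_irrefl)
    then have "connected ((\<lambda>x. q x / p x) ` {0<..})"
      by (rule connected_continuous_image) simp
    moreover have "1 \<in> (\<lambda>x. q x / p x) ` {0<..}"
      using eq pos[of 1] by (intro image_eqI[of _ _ 1]) auto
    moreover have "r \<in> (\<lambda>x. q x / p x) ` {0<..}"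
      using strict(1) by (auto simp: r_def)
    ultimately have "z \<in> (\<lambda>x. q x / p x) ` {0<..}"
      using that unfolding connected_iff_interval by blast
    then obtain c where "0 < c" "z = q c / p c" by auto
    moreover have "p c \<noteq> 0" using pos[OF \<open>0 < c\<close>] by simp
    ultimately show ?thesis by (intro exI[of _ c]) simp
  qed
  then obtain g where g: "\<And>z. 1 \<le> z \<Longrightarrow> z \<le> r \<Longrightarrow> 0 < g z \<and> q (g z) = z * p (g z)"
    by metis
  \<comment> \<open>The hypothesis only compares pairs with ratio at most \<open>r\<close>, since \<open>q / p\<close> may be bounded.\<close>
  have close: "mat_fun f (diag_congruence n T x) \<le>\<^sub>L mat_fun f (diag_congruence n T y)"
    if T: "T \<in> carrier_mat n n" "invertible_mat T"
      and xy: "\<And>i. i < n \<Longrightarrow> 0 < x i" "\<And>i. i < n \<Longrightarrow> x i \<le> y i" "\<And>i. i < n \<Longrightarrow> y i \<le> r * x i"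
    for n T and x y :: "nat \<Rightarrow> real"
  proof -
    \<comment> \<open>With \<open>c = b / a\<close>, the equations \<open>a * p c = x\<close> and
      \<open>a * q c = y\<close> divide to \<open>q c / p c = y / x\<close>, which \<open>g\<close>
      solves; the first equation then yields \<open>a\<close>.\<close>
    define c where "c i = g (y i / x i)" for i
    define a where "a i = x i / p (c i)" for i
    define b where "b i = a i * c i" for i
    have c: "0 < c i" "q (c i) = y i / x i * p (c i)" if "i < n" for i
      using g[of "y i / x i"] xy that by (simp_all add: c_def field_simps)
    have a: "0 < a i" if "i < n" for i
      using xy(1)[OF that] pos[OF c(1)[OF that]] by (simp add: a_def)
    have b: "0 < b i" if "i < n" for i
      using a[OF that] c(1)[OF that] by (simp add: b_def)
    have "a i * p (b i / a i) = x i" "a i * q (b i / a i) = y i" if "i < n" for i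
    proof -
      have "b i / a i = c i" using a[OF that] by (simp add: b_def)
      then show "a i * p (b i / a i) = x i" "a i * q (b i / a i) = y i"
        using pos[OF c(1)[OF that]] xy(1)[OF that] c(2)[OF that] by (simp_all add: a_def)
    qed
    then have "diag_congruence n T (\<lambda>i. a i * p (b i / a i)) = diag_congruence n T x"
      "diag_congruence n T (\<lambda>i. a i * q (b i / a i)) = diag_congruence n T y"
      by (auto intro!: diag_congruence_cong)
    then have "M (diag_congruence n T a) (diag_congruence n T b) = diag_congruence n T x"
      "N (diag_congruence n T a) (diag_congruence n T b) = diag_congruence n T y"
      using entrywise_meanD[OF M T a b] entrywise_meanD[OF N T a b] by simp_all
    moreover have "pos_def_mat (diag_congruence n T a)" "pos_def_mat (diag_congruence n T b)"
      using a b by (simp_all add: pos_def_diag_congruence_iff[OF T])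
    ultimately show ?thesis
      using cmp[rule_format, of "diag_congruence n T a" n "diag_congruence n T b"] T by simp
  qed
  have chain: "mat_fun f (diag_congruence n T x) \<le>\<^sub>L mat_fun f (diag_congruence n T y)"
    if T: "T \<in> carrier_mat n n" "invertible_mat T"
      and xy: "\<And>i. i < n \<Longrightarrow> 0 < x i" "\<And>i. i < n \<Longrightarrow> x i \<le> y i" "\<And>i. i < n \<Longrightarrow> y i \<le> r ^ m * x i"
    for n T m and x y :: "nat \<Rightarrow> real"
    using xy
  proof (induction m arbitrary: x)
    case 0
    \<comment> \<open>For exponent 0 the bounds force \<open>y i = x i\<close> below
      \<open>n\<close>, a ratio that \<open>close\<close> already covers.\<close>
    show ?case
    proof (rule close[OF T])
      fix i assume "i < n"
      then have "y i \<le> x i" "0 < x i" using "0.prems" by fastforce+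
      moreover have "x i \<le> r * x i" using r \<open>0 < x i\<close> by simp
      ultimately show "y i \<le> r * x i" by linarith
    qed (use 0 in auto)
  next
    case (Suc m)
    \<comment> \<open>Advance each coefficient by the factor \<open>r\<close>, but not past its
      target; the remaining ratio is at most \<open>r ^ m\<close>.\<close>
    define z where "z i = min (y i) (r * x i)" for i
    have xz: "x i \<le> z i" if "i < n" for i
    proof -
      have "x i \<le> r * x i" using r Suc.prems(1)[OF that] by simp
      then show ?thesis using Suc.prems(2)[OF that] by (simp add: z_def)
    qed
    have "mat_fun f (diag_congruence n T x) \<le>\<^sub>L mat_fun f (diag_congruence n T z)"
      by (rule close[OF T]) (use Suc.prems(1) xz in \<open>auto simp: z_def\<close>)
    moreover have "mat_fun f (diag_congruence n T z) \<le>\<^sub>L mat_fun f (diag_congruence n T y)"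
    proof (rule Suc.IH)
      fix i assume i: "i < n"
      show "0 < z i" using xz[OF i] Suc.prems(1)[OF i] by simp
      show "z i \<le> y i" by (simp add: z_def)
      \<comment> \<open>Where \<open>z i\<close> has already reached \<open>y i\<close>, the bound
        to prove is \<open>y i \<le> r ^ m * y i\<close>.\<close>
      have "1 \<le> r ^ m" using r by (simp add: one_le_power)
      moreover have "0 < y i" using Suc.prems(1,2)[OF i] by simp
      ultimately have "y i \<le> r ^ m * y i" by simp
      then show "y i \<le> r ^ m * z i"
        using Suc.prems(3)[OF i] by (simp add: z_def min_def mult.assoc power_Suc2 del: power_Suc)
    qed
    moreover have "mat_fun f (diag_congruence n T u) \<in> carrier_mat n n" for u
      using T(1) by (intro mat_fun_carrier diag_congruence_carrier diag_congruence_hermitian)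
    ultimately show ?case
      by (blast intro: loewner_le_trans)
  qed
  show ?L
  proof (rule operator_monotone_if_pos_def[OF f])
    fix n X Y assume X: "X \<in> carrier_mat n n" "pos_def_mat X" and Y: "Y \<in> carrier_mat n n" "pos_def_mat Y"
      and XY: "X \<le>\<^sub>L Y"
    from Y(2) have "hermitian_mat Y" by (simp add: pos_def_mat_def)
    then obtain T y where T: "T \<in> carrier_mat n n" "invertible_mat T"
      and XT: "X = diag_congruence n T (\<lambda>i. 1)" and YT: "Y = diag_congruence n T y"
      using simultaneous_diag_congruence X Y(1) by metis
    have y: "\<forall>i<n. 1 \<le> y i"
      using XY unfolding XT YT loewner_le_diag_congruence_iff[OF T] .
    \<comment> \<open>Each coefficient has its own exponent; the sum of the exponents dominates them
      all and serves as common chain length.\<close>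
    have "\<forall>i. \<exists>k. y i < r ^ k" using real_arch_pow[OF r] by blast
    then obtain k where k: "\<And>i. y i < r ^ k i" by metis
    have "y i \<le> r ^ (\<Sum>j<n. k j) * 1" if "i < n" for i
    proof -
      have "k i \<le> (\<Sum>j<n. k j)" using that by (intro member_le_sum) auto
      then have "r ^ k i \<le> r ^ (\<Sum>j<n. k j)" using r by (intro power_increasing) auto
      then show ?thesis using k[of i] by simp
    qed
    then show "mat_fun f X \<le>\<^sub>L mat_fun f Y"
      unfolding XT YT using y by (intro chain[OF T]) auto
  qed
qed

subsection \<open>The scalar inequalities\<close>

text \<open>The gap \<open>a * sinh t - sinh (a * t)\<close> vanishes at 0 and has derivative
  \<open>a * (cosh t - cosh (a * t))\<close>, positive for \<open>t > 0\<close>.\<close>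

lemma sinh_scale_less:
  fixes a y :: real
  assumes "0 < a" "a < 1" "0 < y"
  shows "sinh (a * y) < a * sinh y"
proof -
  have "a * sinh 0 - sinh (a * 0) < a * sinh y - sinh (a * y)"
  proof (rule DERIV_pos_imp_increasing_open[OF \<open>0 < y\<close>])
    fix t :: real assume "0 < t"
    have "cosh (a * t) < cosh t"
      using assms \<open>0 < t\<close> by (intro cosh_real_strict_mono) auto
    then have "0 < a * cosh t - cosh (a * t) * a" using assms(1) by simp
    moreover have "((\<lambda>t. a * sinh t - sinh (a * t)) has_real_derivative a * cosh t - cosh (a * t) * a) (at t)"
      by (auto intro!: derivative_eq_intros)
    ultimately show "\<exists>z. ((\<lambda>t. a * sinh t - sinh (a * t)) has_real_derivative z) (at t) \<and> 0 < z"
      by blast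
  qed (intro continuous_intros)
  then show ?thesis by simp
qed

text \<open>The half-argument formula for cosh turns the claim into a comparison of the squares of
  \<open>sinh (a * w / 2)\<close> and \<open>a * sinh (w / 2)\<close>.\<close>

lemma cosh_scale_less:
  fixes a w :: real
  assumes "a \<noteq> 0" "\<bar>a\<bar> < 1" "w \<noteq> 0"
  shows "cosh (a * w) < a\<^sup>2 * cosh w + (1 - a\<^sup>2)"
proof -
  have half: "cosh v = 1 + 2 * (sinh (v / 2))\<^sup>2" for v :: real
    using cosh_double[of "v / 2"] cosh_square_eq[of "v / 2"] by simp
  \<comment> \<open>Both \<open>a\<close> and \<open>w\<close> may be negative; sinh is odd, so
    absolute values reduce to the positive case and disappear on squaring.\<close>
  have "sinh (\<bar>a\<bar> * \<bar>w / 2\<bar>) < \<bar>a\<bar> * sinh \<bar>w / 2\<bar>"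
    using assms by (intro sinh_scale_less) auto
  then have "\<bar>sinh (a * (w / 2))\<bar> < \<bar>a * sinh (w / 2)\<bar>"
    by (simp only: sinh_real_abs flip: abs_mult)
  then have "(sinh (a * (w / 2)))\<^sup>2 < (a * sinh (w / 2))\<^sup>2"
    by (metis abs_le_square_iff not_le)
  then show ?thesis
    unfolding half[of w] half[of "a * w"] by (simp add: power_mult_distrib algebra_simps)
qed


section \<open>Comparison of the geometric, Heinz, Heron and arithmetic means\<close>

theorem theorem17:
  fixes f :: "real \<Rightarrow> real" and s \<alpha> :: real
  assumes "continuous_on {0..} f"
    and "s \<in> {0<..<1/2} \<union> {1/2<..<1}"
    and "\<alpha> = 1 - 2 * s"
  shows "(operator_monotone f \<longleftrightarrow>
      (\<forall>n. \<forall>A \<in> carrier_mat n n. \<forall>B \<in> carrier_mat n n. pos_def_mat A \<longrightarrow> pos_def_mat B \<longrightarrow>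
        mat_fun f (A \<sharp>\<^bsub>1/2\<^esub> B)
          \<le>\<^sub>L mat_fun f (complex_of_real (1/2) \<cdot>\<^sub>m (A \<sharp>\<^bsub>s\<^esub> B + A \<sharp>\<^bsub>1 - s\<^esub> B))))
    \<and> (operator_monotone f \<longleftrightarrow>
      (\<forall>n. \<forall>A \<in> carrier_mat n n. \<forall>B \<in> carrier_mat n n. pos_def_mat A \<longrightarrow> pos_def_mat B \<longrightarrow>
        mat_fun f (complex_of_real (1/2) \<cdot>\<^sub>m (A \<sharp>\<^bsub>s\<^esub> B + A \<sharp>\<^bsub>1 - s\<^esub> B))
          \<le>\<^sub>L mat_fun f (complex_of_real (\<alpha>\<^sup>2) \<cdot>\<^sub>m (complex_of_real (1/2) \<cdot>\<^sub>m (A + B))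
                        + complex_of_real (1 - \<alpha>\<^sup>2) \<cdot>\<^sub>m (A \<sharp>\<^bsub>1/2\<^esub> B))))
    \<and> (operator_monotone f \<longleftrightarrow>
      (\<forall>n. \<forall>A \<in> carrier_mat n n. \<forall>B \<in> carrier_mat n n. pos_def_mat A \<longrightarrow> pos_def_mat B \<longrightarrow>
        mat_fun f (complex_of_real (\<alpha>\<^sup>2) \<cdot>\<^sub>m (complex_of_real (1/2) \<cdot>\<^sub>m (A + B))
                        + complex_of_real (1 - \<alpha>\<^sup>2) \<cdot>\<^sub>m (A \<sharp>\<^bsub>1/2\<^esub> B))
          \<le>\<^sub>L mat_fun f (complex_of_real (1/2) \<cdot>\<^sub>m (A + B))))"
proof -
  \<comment> \<open>The representing functions of the four means in increasing order: geometric,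
    Heinz, Heron (a mixture of arithmetic and geometric) and arithmetic.\<close>
  define p where "p x = x powr (1/2)" for x :: real
  define h where "h x = 1/2 * (x powr s + x powr (1 - s))" for x :: real
  define k where "k x = \<alpha>\<^sup>2 * (1/2 * (1 + x)) + (1 - \<alpha>\<^sup>2) * x powr (1/2)" for x :: real
  define m where "m x = 1/2 * (1 + x)" for x :: real
  note defs = p_def[abs_def] h_def[abs_def] k_def[abs_def] m_def[abs_def]
  have means: "entrywise_mean p (\<lambda>A B. A \<sharp>\<^bsub>1/2\<^esub> B)"
    "entrywise_mean h (\<lambda>A B. complex_of_real (1/2) \<cdot>\<^sub>m (A \<sharp>\<^bsub>s\<^esub> B + A \<sharp>\<^bsub>1 - s\<^esub> B))"
    "entrywise_mean k (\<lambda>A B. complex_of_real (\<alpha>\<^sup>2) \<cdot>\<^sub>m (complex_of_real (1/2) \<cdot>\<^sub>m (A + B))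
      + complex_of_real (1 - \<alpha>\<^sup>2) \<cdot>\<^sub>m (A \<sharp>\<^bsub>1/2\<^esub> B))"
    "entrywise_mean m (\<lambda>A B. complex_of_real (1/2) \<cdot>\<^sub>m (A + B))"
    unfolding defs
    by (intro entrywise_mean_geom_mean entrywise_mean_add entrywise_mean_sum entrywise_mean_smult)+
  have cont: "continuous_on {0<..} p" "continuous_on {0<..} h" "continuous_on {0<..} k"
    "continuous_on {0<..} m"
    unfolding defs by (auto intro!: continuous_intros)
  \<comment> \<open>Strictness rests on this: \<open>s \<noteq> 1/2\<close> excludes
    \<open>\<alpha> = 0\<close>, and \<open>0 < s < 1\<close> bounds \<open>\<alpha>\<close> away
    from 1 and -1.\<close>
  have \<alpha>: "\<alpha> \<noteq> 0" "\<bar>\<alpha>\<bar> < 1" using assms(2,3) by auto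
  then have \<alpha>2: "\<alpha>\<^sup>2 < 1" by (simp add: abs_square_less_1)
  \<comment> \<open>After \<open>x = exp (2 * w)\<close> the four functions differ by hyperbolic cosines only.\<close>
  have cosh_form: "p x = exp w" "h x = exp w * cosh (\<alpha> * w)"
    "k x = exp w * (\<alpha>\<^sup>2 * cosh w + (1 - \<alpha>\<^sup>2))" "m x = exp w * cosh w"
    if "0 < x" "w = ln x / 2" for x w
  proof -
    have "2 * w = ln x" using that(2) by simp
    then have x: "x = exp (2 * w)" using that(1) by (metis exp_ln)
    show p: "p x = exp w" by (simp add: p_def x powr_def)
    \<comment> \<open>Here \<open>s = (1 - \<alpha>) / 2\<close>, so the two powers are the
      exponentials of \<open>(1 - \<alpha>) * w\<close> and \<open>(1 + \<alpha>) * w\<close>; with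
      \<open>exp w\<close> factored out, their average is a hyperbolic cosine.\<close>
    show "h x = exp w * cosh (\<alpha> * w)"
      by (simp add: h_def x powr_def cosh_def assms(3) algebra_simps flip: exp_add)
    show m: "m x = exp w * cosh w"
      by (simp add: m_def x cosh_def algebra_simps flip: exp_add)
    have "k x = \<alpha>\<^sup>2 * m x + (1 - \<alpha>\<^sup>2) * p x" by (simp add: k_def m_def p_def)
    then show "k x = exp w * (\<alpha>\<^sup>2 * cosh w + (1 - \<alpha>\<^sup>2))"
      by (simp add: m p algebra_simps)
  qed
  have less: "p x < h x" "h x < k x" "k x < m x" if "0 < x" "x \<noteq> 1" for x
  proof -
    define w where "w = ln x / 2"
    have w: "w \<noteq> 0" using that by (simp add: w_def)
    have 1: "1 < cosh v" if "v \<noteq> 0" for v :: real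
      using that cosh_real_ge_1[of v] cosh_real_one_iff[of v] by linarith
    note c = cosh_form[OF that(1) w_def]
    show "p x < h x" using 1[of "\<alpha> * w"] w \<alpha> by (simp add: c)
    show "h x < k x" using cosh_scale_less[OF \<alpha> w] by (simp add: c)
    \<comment> \<open>Up to the factor \<open>exp w\<close>, \<open>k x\<close> averages
      \<open>cosh w\<close> and 1, and the weight of 1 is positive.\<close>
    have "0 < (1 - \<alpha>\<^sup>2) * (cosh w - 1)" using 1[OF w] \<alpha>2 by simp
    then have "\<alpha>\<^sup>2 * cosh w + (1 - \<alpha>\<^sup>2) < cosh w" by (simp add: algebra_simps)
    then show "k x < m x" by (simp only: c mult_less_cancel_left_pos[OF exp_gt_zero])
  qed
  have at_1: "p 1 = h 1" "h 1 = k 1" "k 1 = m 1"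
    by (simp_all add: defs)
  have pos: "0 < p x" "0 < h x" "0 < k x" and le: "p x \<le> h x" "h x \<le> k x" "k x \<le> m x"
    if "0 < x" for x
  proof -
    show "0 < p x" using that by (simp add: p_def)
    moreover show "p x \<le> h x" "h x \<le> k x" "k x \<le> m x"
      using less[OF that] at_1 by (cases "x = 1"; force)+
    ultimately show "0 < h x" "0 < k x" by linarith+
  qed
  \<comment> \<open>The point of strict inequality \<open>x0\<close>; any positive number other than
    1 would do.\<close>
  have 2: "0 < (2 :: real)" "(2 :: real) \<noteq> 1" by simp_all
  show ?thesis
    using operator_monotone_iff_mean_comparison[OF assms(1) means(1,2) cont(1,2) pos(1) le(1) at_1(1) 2(1) less(1)[OF 2]]
      operator_monotone_iff_mean_comparison[OF assms(1) means(2,3) cont(2,3) pos(2) le(2) at_1(2) 2(1) less(2)[OF 2]]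
      operator_monotone_iff_mean_comparison[OF assms(1) means(3,4) cont(3,4) pos(3) le(3) at_1(3) 2(1) less(3)[OF 2]]
    by (intro conjI)
qed

end
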